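(* Let $L_n$ denote the size of the largest block in a random non-crossing partition of $[n]$. Let an integer $k=\lfloor\log_2 n\rfloor+x$, and define $\alpha(n)=2^{\{\log_2 n\}}\in[1,2)$. Then, as $n\to\infty$, $$\mathbb{P}[L_n\le k]=\exp\Big(-\alpha(n)\,2^{-(x+1)}\Big)\Big(1+O\big(n^{-1}\log^2 n\big)\Big).$$
   Context: A partition of the ordered set $[n]=\{1,2,\dots,n\}$ into subsets, called blocks, is non-crossing if there are no elements $a<b<c<d$ such that $a$ and $c$ are in one block and $b$ and $d$ are in a different block. A random non-crossing partition of $[n]$ is one selected from the uniform distribution on the set of all non-crossing partitions of $[n]$. The size of a block is its number of elements. $\lfloor t\rfloor$ denotes the largest integer $\le t$, and $\{t\}=t-\lfloor t\rfloor$ denotes the fractional part of $t$. *)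

theory Defs
  imports "HOL-Probability.Probability" "HOL-Library.Landau_Symbols" "HOL-Library.Disjoint_Sets"
begin

definition noncrossing :: "nat set set \<Rightarrow> bool" where
  "noncrossing P \<longleftrightarrow>
     \<not> (\<exists>A\<in>P. \<exists>B\<in>P. A \<noteq> B \<and>
          (\<exists>a b c d. a < b \<and> b < c \<and> c < d \<and> a \<in> A \<and> c \<in> A \<and> b \<in> B \<and> d \<in> B))"

definition noncrossing_partitions :: "nat \<Rightarrow> nat set set set" where
  "noncrossing_partitions n = {P. partition_on {1..n} P \<and> noncrossing P}"

lemma finite_noncrossing_partitions: "finite (noncrossing_partitions n)"
proof (rule finite_subset)
  show "noncrossing_partitions n \<subseteq> Pow (Pow {1..n})"
    by (auto simp: noncrossing_partitions_def partition_on_def)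
qed simp

lemma noncrossing_partitions_nonempty: "noncrossing_partitions n \<noteq> {}"
proof (cases "n = 0")
  case True
  then have "{} \<in> noncrossing_partitions n"
    by (simp add: noncrossing_partitions_def noncrossing_def partition_on_def)
  then show ?thesis by blast
next
  case False
  then have "{{1..n}} \<in> noncrossing_partitions n"
    by (simp add: noncrossing_partitions_def noncrossing_def partition_on_def)
  then show ?thesis by blast
qed

(* By the two lemmas above, pmf_of_set is applied within its intended domain. *)
definition random_noncrossing_partition :: "nat \<Rightarrow> nat set set pmf" where
  "random_noncrossing_partition n = pmf_of_set (noncrossing_partitions n)"

(* Unspecified for the partition of the empty set, i.e. for n = 0; this is irrelevant
   for asymptotics. *)
definition largest_block_size :: "nat set set \<Rightarrow> nat" where
  "largest_block_size P = Max (card ` P)"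

definition alpha :: "nat \<Rightarrow> real" where
  "alpha n = 2 powr frac (log 2 (real n))"

end

theory Submission imports Defs begin

text \<open>
  The probability has an exact inclusion-exclusion formula whose terms are, up to a relative error
  of order \<open>j\<^sup>2 log\<^sup>2 n / n\<close>, the terms of an exponential series.

  \<^item> Counting. Reading \<open>1, \<dots>, n\<close> from left to right and recording at the minimum of each block its
    size, and \<open>0\<close> elsewhere, turns a non-crossing partition into a sequence summing to \<open>n\<close> whose
    sum up to \<open>t\<close> is at least \<open>t\<close> for every \<open>t \<le> n\<close>. This is a bijection: the block with the largest
    minimum is not interrupted by any other block, so the sequence determines it, and it can be
    removed (\<open>noncrossing_opening_sizes_inject\<close>, \<open>ex_noncrossing_opening_sizes\<close>). Blocks of
    size at most \<open>k\<close> correspond to entries at most \<open>k\<close>. By the cycle lemma (\<open>cycle_lemma\<close>), after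
    appending a \<open>0\<close> these sequences are exactly one in \<open>n + 1\<close> of all words of length \<open>n + 1\<close> with
    sum \<open>n\<close> and entries at most \<open>k\<close>.

  \<^item> Exact formula. Such words are counted by the coefficient of \<open>z^n\<close> in
    \<open>((1 - z^(k+1)) / (1 - z))^(n+1)\<close>. The factor \<open>n + 1\<close> cancels against the same factor in the
    count of all non-crossing partitions, so the probability is the alternating sum over \<open>j\<close> of
    \<open>C(n+1, j) C(2n - j(k+1), n) / C(2n, n)\<close> (\<open>prob_largest_block_le\<close>).

  \<^item> Asymptotics. Here \<open>C(n+1, j)\<close> is close to \<open>n^j / j!\<close>, and the quotient of binomial coefficients
    is close to \<open>2^(-j(k+1))\<close>, since it is a product of \<open>j(k+1)\<close> factors \<open>(n - i) / (2n - i)\<close>. With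
    \<open>lam = n / 2^(k+1)\<close> the \<open>j\<close>-th term is \<open>lam^j / j!\<close> up to a relative error
    \<open>2 j\<^sup>2 (k+1)\<^sup>2 / n\<close>. Summing over \<open>j\<close> gives \<open>exp (-lam)\<close> with error
    \<open>2 (k+1)\<^sup>2 exp (4 lam) / n\<close> (\<open>prob_largest_block_le_approx\<close>). For \<open>k = \<lfloor>log\<^sub>2 n\<rfloor> + x\<close> the number
    \<open>lam\<close> is exactly \<open>\<alpha>(n) 2^(-(x+1))\<close>. It stays bounded, so the absolute error is also a relative
    error, of order \<open>log\<^sup>2 n / n\<close>.
\<close>

section \<open>Non-crossing partitions and dominating sequences\<close>

text \<open>
  A sum over the blocks with minimum \<open>i\<close>, of which a partition has at most one: this gives the
  value \<open>0\<close> where no block starts, and lets partial sums be rearranged into sums over blocks.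
\<close>
definition opening_sizes :: "nat set set \<Rightarrow> nat \<Rightarrow> nat" where
  "opening_sizes P i = (\<Sum>B | B \<in> P \<and> Min B = i. card B)"

text \<open>
  The sequences that arise as opening sizes. The index set is an arbitrary set of numbers instead of
  an initial interval so that a block can be deleted without renumbering the remaining elements.
\<close>
definition dominating :: "nat set \<Rightarrow> (nat \<Rightarrow> nat) \<Rightarrow> bool" where
  "dominating S a \<longleftrightarrow> (\<forall>i. i \<notin> S \<longrightarrow> a i = 0) \<and> sum a S = card S \<and>
     (\<forall>t. card {i \<in> S. i \<le> t} \<le> sum a {i \<in> S. i \<le> t})"

lemma partition_on_block:
  assumes "finite S" "partition_on S P" "B \<in> P"
  shows "finite B" "B \<noteq> {}" "B \<subseteq> S" "Min B \<in> B" "card B > 0"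
proof -
  show "B \<noteq> {}" "B \<subseteq> S"
    using assms by (auto simp: partition_on_def)
  then show "finite B"
    using assms(1) finite_subset by blast
  with \<open>B \<noteq> {}\<close> show "Min B \<in> B" "card B > 0"
    by (auto simp: card_gt_0_iff)
qed

lemma eq_block_of_Min_eq:
  assumes "finite S" "partition_on S P" "B \<in> P" "C \<in> P" "Min B = Min C"
  shows "B = C"
proof -
  have "Min C \<in> B \<inter> C"
    using partition_on_block(4)[OF assms(1-3)] partition_on_block(4)[OF assms(1,2,4)] assms(5)
    by auto
  then show ?thesis
    using assms(2-4) by (auto simp: partition_on_def disjoint_def)
qed

lemma sum_opening_sizes:
  assumes "finite P" "finite T"
  shows "sum (opening_sizes P) T = (\<Sum>B | B \<in> P \<and> Min B \<in> T. card B)"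
proof -
  have "sum (opening_sizes P) T = (\<Sum>i\<in>T. \<Sum>B\<in>P. if Min B = i then card B else 0)"
    unfolding opening_sizes_def using assms(1)
    by (intro sum.cong refl sum.inter_filter)
  also have "\<dots> = (\<Sum>B\<in>P. \<Sum>i\<in>T. if Min B = i then card B else 0)"
    by (rule sum.swap)
  also have "\<dots> = (\<Sum>B\<in>P. if Min B \<in> T then card B else 0)"
    using assms(2) by (intro sum.cong refl) simp
  also have "\<dots> = (\<Sum>B | B \<in> P \<and> Min B \<in> T. card B)"
    using assms(1) by (rule sum.inter_filter[symmetric])
  finally show ?thesis .
qed

lemma card_partition_blocks:
  fixes S :: "nat set"
  assumes "finite S" "partition_on S P" "Q \<subseteq> P"
  shows "card (\<Union>Q) = sum card Q"
proof (rule card_Union_disjoint)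
  show "pairwise disjnt Q"
    using assms(2,3) unfolding partition_on_def disjoint_def pairwise_def disjnt_def by blast
  show "finite B" if "B \<in> Q" for B
    using that assms(3) partition_on_block(1)[OF assms(1,2)] by blast
qed

text \<open>
  The sum of the opening sizes up to \<open>t\<close> is the total size of the blocks with minimum at most \<open>t\<close>,
  and those blocks cover every element up to \<open>t\<close>.
\<close>
lemma dominating_opening_sizes:
  assumes fin: "finite S" and part: "partition_on S P"
  shows "dominating S (opening_sizes P)"
proof -
  have finP: "finite P"
    using fin part finite_elements by blast
  have block: "finite B" "Min B \<in> B" "B \<subseteq> S" if "B \<in> P" for B
    using partition_on_block[OF fin part that] by auto
  have "opening_sizes P i = 0" if "i \<notin> S" for i
  proof -
    have "{B. B \<in> P \<and> Min B = i} = {}"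
      using block that by blast
    then show ?thesis
      unfolding opening_sizes_def by (metis sum.empty)
  qed
  moreover have "sum (opening_sizes P) S = card S"
  proof -
    have "{B. B \<in> P \<and> Min B \<in> S} = P"
      using block by blast
    then show ?thesis
      using sum_opening_sizes[OF finP fin] card_partition_blocks[OF fin part, of P] part
      by (simp add: partition_on_def)
  qed
  moreover have "card {i \<in> S. i \<le> t} \<le> sum (opening_sizes P) {i \<in> S. i \<le> t}" for t
  proof -
    let ?Q = "{B. B \<in> P \<and> Min B \<in> {i \<in> S. i \<le> t}}"
    have "{i \<in> S. i \<le> t} \<subseteq> \<Union>?Q"
    proof
      fix i assume i: "i \<in> {i \<in> S. i \<le> t}"
      then obtain B where B: "B \<in> P" "i \<in> B"
        using part by (auto simp: partition_on_def)
      then have "Min B \<le> i"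
        using block(1) by simp
      moreover have "Min B \<in> S"
        using block(2,3)[OF B(1)] by blast
      ultimately have "B \<in> ?Q"
        using B i by auto
      with B(2) show "i \<in> \<Union>?Q"
        by blast
    qed
    moreover have "finite (\<Union>?Q)"
      using block(3) by (intro finite_subset[OF _ fin]) blast
    ultimately have "card {i \<in> S. i \<le> t} \<le> card (\<Union>?Q)"
      by (rule card_mono[rotated])
    also have "\<dots> = sum (opening_sizes P) {i \<in> S. i \<le> t}"
      using sum_opening_sizes[OF finP, of "{i \<in> S. i \<le> t}"]
        card_partition_blocks[OF fin part, of ?Q] fin by auto
    finally show ?thesis .
  qed
  ultimately show ?thesis
    by (auto simp: dominating_def)
qed

lemma opening_sizes_Min:
  assumes "finite S" "partition_on S P" "B \<in> P"
  shows "opening_sizes P (Min B) = card B"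
proof -
  have "{C. C \<in> P \<and> Min C = Min B} = {B}"
    using eq_block_of_Min_eq[OF assms(1,2) _ assms(3)] assms(3) by blast
  then show ?thesis
    by (simp add: opening_sizes_def)
qed

lemma opening_sizes_pos_iff:
  assumes "finite S" "partition_on S P"
  shows "opening_sizes P i > 0 \<longleftrightarrow> (\<exists>B\<in>P. Min B = i)"
proof
  assume "opening_sizes P i > 0"
  then have "{B. B \<in> P \<and> Min B = i} \<noteq> {}"
    unfolding opening_sizes_def by (metis less_irrefl sum.empty)
  then show "\<exists>B\<in>P. Min B = i" by blast
next
  assume "\<exists>B\<in>P. Min B = i"
  then show "opening_sizes P i > 0"
    using opening_sizes_Min[OF assms] partition_on_block(5)[OF assms] by auto
qed

definition initial_segment :: "nat set \<Rightarrow> nat set \<Rightarrow> bool" where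
  "initial_segment B S \<longleftrightarrow> B \<subseteq> S \<and> (\<forall>b\<in>B. \<forall>s\<in>S. s \<le> b \<longrightarrow> s \<in> B)"

lemma initial_segment_eqI:
  assumes "initial_segment B S" "initial_segment C S" "finite S" "card B = card C"
  shows "B = C"
proof -
  have "B \<subseteq> C \<or> C \<subseteq> B"
    using assms(1,2) unfolding initial_segment_def by (meson nat_le_linear subset_iff)
  moreover have "finite B" "finite C"
    using assms(1-3) by (auto simp: initial_segment_def intro: finite_subset)
  ultimately show ?thesis
    using assms(4) by (metis card_subset_eq)
qed

lemma ex_initial_segment:
  assumes "finite S" "m \<le> card S"
  shows "\<exists>B. initial_segment B S \<and> card B = m"
  using assms(2)
proof (induction m)
  case 0
  show ?case by (rule exI[of _ "{}"]) (simp add: initial_segment_def)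
next
  case (Suc m)
  then obtain B where B: "initial_segment B S" "card B = m" by auto
  then have sub: "B \<subseteq> S" by (simp add: initial_segment_def)
  have finB: "finite B" using sub assms(1) finite_subset by blast
  have "S - B \<noteq> {}"
    using Suc.prems B(2) finB card_mono[of B S] by auto
  then have M: "Min (S - B) \<in> S - B"
    using assms(1) by (intro Min_in) auto
  have "Min (S - B) \<le> s" if "s \<in> S" "s \<notin> B" for s
    using that assms(1) by (intro Min_le) auto
  then have "s \<in> insert (Min (S - B)) B" if "s \<in> S" "s \<le> Min (S - B)" for s
    using that by (metis antisym insert_iff)
  moreover have "s \<in> B" if "b \<in> B" "s \<in> S" "s \<le> b" for b s
    using that B(1) by (auto simp: initial_segment_def)
  ultimately have "initial_segment (insert (Min (S - B)) B) S"
    using M sub unfolding initial_segment_def by blast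
  moreover have "card (insert (Min (S - B)) B) = Suc m"
    using M finB B(2) by simp
  ultimately show ?case by blast
qed

text \<open>
  If an element between the minimum and another element of the last opened block \<open>B\<close> were missing
  from \<open>B\<close>, its own block would start before \<open>B\<close> and hence cross \<open>B\<close>.
\<close>
lemma last_opened_block_initial:
  assumes fin: "finite S" and part: "partition_on S P" and nc: "noncrossing P"
    and B: "B \<in> P" and last: "\<And>C. C \<in> P \<Longrightarrow> Min C \<le> Min B"
  shows "initial_segment B {s \<in> S. Min B \<le> s}"
proof -
  have block: "finite B" "Min B \<in> B" "B \<subseteq> S" if "B \<in> P" for B
    using partition_on_block[OF fin part that] by auto
  have "s \<in> B" if b: "b \<in> B" and s: "s \<in> S" "Min B \<le> s" "s \<le> b" for b s
  proof (rule ccontr)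
    assume sB: "s \<notin> B"
    obtain C where C: "C \<in> P" "s \<in> C"
      using s part by (auto simp: partition_on_def)
    have neq: "C \<noteq> B" using C sB by blast
    have "Min C \<noteq> Min B"
      using eq_block_of_Min_eq[OF fin part C(1) B] neq by blast
    then have "Min C < Min B" using last[OF C(1)] by simp
    moreover have "Min B < s" "s < b"
      using s sB b block(2)[OF B] by (metis le_neq_implies_less)+
    ultimately show False
      using nc C B neq block(2)[OF C(1)] block(2)[OF B] b unfolding noncrossing_def by blast
  qed
  moreover have "B \<subseteq> {s \<in> S. Min B \<le> s}"
    using block(1,3)[OF B] by auto
  ultimately show ?thesis
    by (auto simp: initial_segment_def)
qed

lemma partition_on_remove_block:
  assumes "partition_on S P" "B \<in> P"
  shows "partition_on (S - B) (P - {B})"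
proof (rule partition_onI)
  show "\<Union>(P - {B}) = S - B"
    using assms unfolding partition_on_def disjoint_def by fast
qed (use assms in \<open>auto simp: partition_on_def disjoint_def disjnt_def\<close>)

lemma opening_sizes_remove_block:
  assumes "finite S" "partition_on S P" "B \<in> P"
  shows "opening_sizes (P - {B}) i = (if i = Min B then 0 else opening_sizes P i)"
proof (cases "i = Min B")
  case True
  have "{C. C \<in> P - {B} \<and> Min C = i} = {}"
    using True eq_block_of_Min_eq[OF assms(1,2) _ assms(3)] by blast
  then show ?thesis
    using True unfolding opening_sizes_def by (metis sum.empty)
next
  case False
  then have "{C. C \<in> P - {B} \<and> Min C = i} = {C. C \<in> P \<and> Min C = i}"
    by blast
  then have "opening_sizes (P - {B}) i = opening_sizes P i"
    unfolding opening_sizes_def by (rule arg_cong)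
  then show ?thesis
    using False by simp
qed

lemma noncrossing_subset: "noncrossing P \<Longrightarrow> Q \<subseteq> P \<Longrightarrow> noncrossing Q"
  unfolding noncrossing_def by blast

text \<open>
  Equal opening sizes force the last opened blocks to start at the same element and to have the same
  size; both are initial segments of what follows, hence equal. Removing this common block
  leaves a smaller instance.
\<close>
lemma noncrossing_opening_sizes_inject:
  assumes "finite S" "partition_on S P" "noncrossing P" "partition_on S Q" "noncrossing Q"
    and "opening_sizes P = opening_sizes Q"
  shows "P = Q"
  using assms
proof (induction S arbitrary: P Q rule: finite_psubset_induct)
  case (psubset S)
  note fin = psubset.hyps
  note P = psubset.prems(1,2) and Q = psubset.prems(3,4) and eq = psubset.prems(5)
  show ?case
  proof (cases "P = {}")
    case True
    then show ?thesis
      using P Q by (auto simp: partition_on_def)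
  next
    case False
    have "finite P" using fin P(1) finite_elements by blast
    have "Max (Min ` P) \<in> Min ` P"
      using False \<open>finite P\<close> by (intro Max_in) auto
    then obtain B where B: "B \<in> P" and MinB: "Min B = Max (Min ` P)"
      by auto
    have Bmax: "Min C \<le> Min B" if "C \<in> P" for C
      unfolding MinB using that \<open>finite P\<close> by (intro Max_ge) auto
    have same_Mins: "(\<exists>C\<in>P. Min C = i) \<longleftrightarrow> (\<exists>C\<in>Q. Min C = i)" for i
      using opening_sizes_pos_iff[OF fin P(1), of i] opening_sizes_pos_iff[OF fin Q(1), of i] eq
      by simp
    obtain C where C: "C \<in> Q" "Min C = Min B"
      using same_Mins[of "Min B"] B by blast
    have Cmax: "Min D \<le> Min C" if D: "D \<in> Q" for D
    proof -
      obtain E where "E \<in> P" "Min E = Min D"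
        using same_Mins[of "Min D"] D by blast
      then show ?thesis using Bmax[of E] C(2) by simp
    qed
    have "card B = card C"
      using opening_sizes_Min[OF fin P(1) B] opening_sizes_Min[OF fin Q(1) C(1)] eq C by simp
    moreover have "initial_segment B {s \<in> S. Min B \<le> s}" "initial_segment C {s \<in> S. Min B \<le> s}"
      using last_opened_block_initial[OF fin P B Bmax] last_opened_block_initial[OF fin Q C(1) Cmax] C
      by auto
    ultimately have BC: "B = C"
      using fin by (intro initial_segment_eqI[of B "{s \<in> S. Min B \<le> s}" C]) auto
    have "S - B \<subset> S"
      using partition_on_block[OF fin P(1) B] by blast
    moreover have "opening_sizes (P - {B}) = opening_sizes (Q - {B})"
      using opening_sizes_remove_block[OF fin P(1) B] opening_sizes_remove_block[OF fin Q(1) C(1)] BC eq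
      by auto
    moreover have "partition_on (S - B) (P - {B})" "partition_on (S - B) (Q - {B})"
      using partition_on_remove_block P(1) Q(1) B C(1) BC by auto
    moreover have "noncrossing (P - {B})" "noncrossing (Q - {B})"
      using noncrossing_subset P(2) Q(2) by (meson Diff_subset)+
    ultimately have "P - {B} = Q - {B}"
      using psubset.IH by blast
    then show ?thesis using B C BC by blast
  qed
qed

text \<open>
  The construction inverts the removal of the last opened block: at the last index \<open>i\<close> with a
  nonzero entry, the next \<open>a i\<close> elements from \<open>i\<close> on are made a block, the entry is set to \<open>0\<close>, and
  the remaining set is partitioned recursively. Domination at the predecessor of \<open>i\<close>
  guarantees that enough elements are left, and consecutive elements cannot cross anything.
\<close>
lemma ex_noncrossing_opening_sizes:
  assumes "finite S" "dominating S a"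
  shows "\<exists>P. partition_on S P \<and> noncrossing P \<and> opening_sizes P = a"
  using assms
proof (induction S arbitrary: a rule: finite_psubset_induct)
  case (psubset S)
  note fin = psubset.hyps
  have supp: "\<And>i. i \<notin> S \<Longrightarrow> a i = 0" and total: "sum a S = card S"
    and dom: "\<And>t. card {i \<in> S. i \<le> t} \<le> sum a {i \<in> S. i \<le> t}"
    using psubset.prems by (auto simp: dominating_def)
  show ?case
  proof (cases "S = {}")
    case True
    have "opening_sizes {} = a"
      using supp True by (auto simp: opening_sizes_def fun_eq_iff)
    then show ?thesis
      using True by (intro exI[of _ "{}"]) (auto simp: partition_on_def noncrossing_def)
  next
    case False
    define i where "i = Max {s \<in> S. a s > 0}"
    have ne: "{s \<in> S. a s > 0} \<noteq> {}"
      using total False fin by (metis (mono_tags, lifting) card_0_eq empty_Collect_eq gr0I sum.neutral)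
    then have i: "i \<in> S" "a i > 0"
      using Max_in[OF _ ne] fin by (auto simp: i_def)
    have after: "a s = 0" if "s > i" for s
    proof (rule ccontr)
      assume "a s \<noteq> 0"
      then have "s \<in> {s \<in> S. a s > 0}" using supp[of s] by auto
      then have "s \<le> i" using fin unfolding i_def by (intro Max_ge) auto
      with that show False by simp
    qed
    let ?U = "{s \<in> S. i \<le> s}" and ?L = "{s \<in> S. s < i}"
    have split: "S = ?L \<union> ?U" "?L \<inter> ?U = {}" by auto
    have "sum a ?U = a i"
    proof -
      have "sum a ?U = sum a {i}"
        using fin i after by (intro sum.mono_neutral_right) (auto simp: le_less)
      then show ?thesis by simp
    qed
      (* Enough elements remain for a block of size a i: the earlier entries sum to at least card ?L. *)
    have L_le: "card ?L \<le> sum a ?L"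
    proof (cases i)
      case (Suc j)
      then have "?L = {s \<in> S. s \<le> j}" by auto
      then show ?thesis using dom[of j] by simp
    qed simp
    have "sum a S = sum a ?L + sum a ?U" "card S = card ?L + card ?U"
      using split fin sum.union_disjoint[of ?L ?U a] card_Un_disjoint[of ?L ?U] by auto
    then have "a i \<le> card ?U"
      using L_le total \<open>sum a ?U = a i\<close> by linarith
    then obtain B where B: "initial_segment B ?U" "card B = a i"
      using ex_initial_segment[of ?U "a i"] fin by auto
    have Bsub: "B \<subseteq> ?U" and Bclosed: "\<And>b s. b \<in> B \<Longrightarrow> s \<in> S \<Longrightarrow> i \<le> s \<Longrightarrow> s \<le> b \<Longrightarrow> s \<in> B"
      using B(1) by (auto simp: initial_segment_def)
    have Bne: "B \<noteq> {}" using B(2) i by auto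
    have finB: "finite B" using Bsub fin by (auto intro: finite_subset)
    have iB: "i \<in> B" using Bne Bsub Bclosed i by blast
    have MinB: "Min B = i"
      using finB iB Bsub by (intro Min_eqI) auto
    define a' where "a' = a(i := 0)"
    have sum_a': "sum a' {s \<in> S - B. s \<le> t} = sum a {s \<in> S. s < i \<and> s \<le> t}" for t
    proof -
      have "sum a' {s \<in> S - B. s \<le> t} = sum a' {s \<in> S. s < i \<and> s \<le> t}"
        using fin Bsub after by (intro sum.mono_neutral_right) (auto simp: a'_def not_less le_less)
      also have "\<dots> = sum a {s \<in> S. s < i \<and> s \<le> t}"
        by (intro sum.cong) (auto simp: a'_def)
      finally show ?thesis .
    qed
    have card_SB: "card (S - B) = sum a ?L"
    proof -
      have "card (S - B) = card S - card B"
        using finB Bsub by (intro card_Diff_subset) auto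
      then show ?thesis
        using B(2) total \<open>sum a S = sum a ?L + sum a ?U\<close> \<open>sum a ?U = a i\<close> by linarith
    qed
    have "dominating (S - B) a'"
      unfolding dominating_def
    proof (intro conjI allI impI)
      fix s assume "s \<notin> S - B"
      then show "a' s = 0"
        using supp after Bsub by (cases "s = i") (auto simp: a'_def le_less)
    next
      have "sum a' (S - B) = sum a' {s \<in> S - B. s \<le> Max (insert 0 S)}"
        using fin by (intro sum.cong) auto
      also have "\<dots> = sum a ?L"
        unfolding sum_a' using fin by (intro sum.cong) auto
      finally show "sum a' (S - B) = card (S - B)" using card_SB by simp
    next
      fix t
      show "card {s \<in> S - B. s \<le> t} \<le> sum a' {s \<in> S - B. s \<le> t}"
      proof (cases "t < i")
        case True
        then have "{s \<in> S - B. s \<le> t} = {s \<in> S. s \<le> t}" "{s \<in> S. s < i \<and> s \<le> t} = {s \<in> S. s \<le> t}"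
          using Bsub by auto
        then show ?thesis using dom[of t] sum_a'[of t] by simp
      next
        case False
        then have "{s \<in> S. s < i \<and> s \<le> t} = ?L" by auto
        moreover have "card {s \<in> S - B. s \<le> t} \<le> card (S - B)"
          using fin by (intro card_mono) auto
        ultimately show ?thesis using card_SB sum_a'[of t] by simp
      qed
    qed
    moreover have "S - B \<subset> S" using Bne Bsub by blast
    ultimately obtain P where P: "partition_on (S - B) P" "noncrossing P" "opening_sizes P = a'"
      using psubset.IH by blast
    have BP: "B \<notin> P" using P(1) Bne by (auto simp: partition_on_def)
    have PS: "C \<subseteq> S" "C \<inter> B = {}" if "C \<in> P" for C
      using P(1) that by (auto simp: partition_on_def)
    have part: "partition_on S (insert B P)"
    proof (subst partition_on_insert)
      show "disjnt B (\<Union>P)"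
        using PS(2) by (auto simp: disjnt_def)
      show "partition_on (S - B) P \<and> B \<subseteq> S \<and> B \<noteq> {}"
        using P(1) Bne Bsub by auto
    qed
    have "noncrossing (insert B P)"
      unfolding noncrossing_def
    proof (rule notI, elim bexE exE conjE)
      fix C D p q r s
      assume CD: "C \<in> insert B P" "D \<in> insert B P" "C \<noteq> D"
        and lt: "p < q" "q < r" "r < s" and mem: "p \<in> C" "r \<in> C" "q \<in> D" "s \<in> D"
      consider "C \<in> P" "D \<in> P" | "C = B" "D \<in> P" | "C \<in> P" "D = B"
        using CD by auto
      then show False
      proof cases
        case 1
        with P(2) CD(3) lt mem show False unfolding noncrossing_def by blast
      next
        case 2
        then have "q \<in> B"
          using Bclosed[of r q] Bsub PS mem lt by fastforce
        with 2 PS mem show False by blast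
      next
        case 3
        then have "r \<in> B"
          using Bclosed[of s r] Bsub PS mem lt by fastforce
        with 3 PS mem show False by blast
      qed
    qed
    moreover have "opening_sizes (insert B P) = a"
    proof
      fix s
      have "a' s = (if s = i then 0 else opening_sizes (insert B P) s)"
        using opening_sizes_remove_block[OF fin part, of B s] BP P(3) MinB by simp
      moreover have "opening_sizes (insert B P) i = a i"
        using opening_sizes_Min[OF fin part, of B] MinB B(2) by simp
      ultimately show "opening_sizes (insert B P) s = a s"
        by (cases "s = i") (auto simp: a'_def)
    qed
    ultimately show ?thesis using part by blast
  qed
qed

lemma card_noncrossing_bounded_blocks:
  "card {P \<in> noncrossing_partitions n. \<forall>B\<in>P. card B \<le> k}
     = card {a. dominating {1..n} a \<and> (\<forall>i. a i \<le> k)}"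
proof (rule bij_betw_same_card[of opening_sizes], rule bij_betw_imageI)
  let ?N = "{P \<in> noncrossing_partitions n. \<forall>B\<in>P. card B \<le> k}"
  let ?D = "{a. dominating {1..n} a \<and> (\<forall>i. a i \<le> k)}"
  show "inj_on opening_sizes ?N"
    using noncrossing_opening_sizes_inject[of "{1..n}"]
    by (auto simp: inj_on_def noncrossing_partitions_def)
  have bounded: "(\<forall>B\<in>P. card B \<le> k) \<longleftrightarrow> (\<forall>i. opening_sizes P i \<le> k)"
    if "partition_on {1..n} P" for P
    using opening_sizes_Min[OF _ that] opening_sizes_pos_iff[OF _ that]
    by (metis finite_atLeastAtMost gr0I le0)
  show "opening_sizes ` ?N = ?D"
  proof (intro subset_antisym subsetI)
    fix a assume "a \<in> opening_sizes ` ?N"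
    then show "a \<in> ?D"
      using dominating_opening_sizes[of "{1..n}"] bounded
      by (auto simp: noncrossing_partitions_def)
  next
    fix a assume a: "a \<in> ?D"
    then obtain P where P: "partition_on {1..n} P" "noncrossing P" "opening_sizes P = a"
      using ex_noncrossing_opening_sizes[of "{1..n}" a] by auto
    then have "P \<in> ?N" using a bounded[OF P(1)] by (auto simp: noncrossing_partitions_def)
    then show "a \<in> opening_sizes ` ?N" using P(3) by blast
  qed
qed


section \<open>Lukasiewicz words and the cycle lemma\<close>

text \<open>
  The Lukasiewicz words: when each letter \<open>x\<close> is read as a step of \<open>x - 1\<close>, every proper prefix
  ends at a nonnegative height.
\<close>
definition lukasiewicz :: "nat list \<Rightarrow> bool" where
  "lukasiewicz w \<longleftrightarrow> (\<forall>j<length w. j \<le> sum_list (take j w))"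

definition bounded_words :: "nat \<Rightarrow> nat \<Rightarrow> nat list set" where
  "bounded_words k n = {w. length w = Suc n \<and> sum_list w = n \<and> (\<forall>x\<in>set w. x \<le> k)}"

lemma sum_list_take: "j \<le> length w \<Longrightarrow> sum_list (take j w) = (\<Sum>i<j. w ! i)" for w :: "nat list"
  by (simp add: sum_list_sum_nth atLeast0LessThan)

lemma finite_bounded_words: "finite (bounded_words k n)"
proof (rule finite_subset)
  show "bounded_words k n \<subseteq> {w. set w \<subseteq> {..k} \<and> length w = Suc n}"
    by (auto simp: bounded_words_def)
qed (simp add: finite_lists_length_eq)

lemma dominating_atLeastAtMost_iff:
  "dominating {1..n} a \<longleftrightarrow> (\<forall>i. i \<notin> {1..n} \<longrightarrow> a i = 0) \<and> (\<Sum>i<n. a (Suc i)) = n \<and>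
     (\<forall>t\<le>n. t \<le> (\<Sum>i<t. a (Suc i)))"
proof -
  have "{i \<in> {1..n}. i \<le> t} = {1..min t n}" for t by auto
  moreover have "sum a {1..m} = (\<Sum>i<m. a (Suc i))" for m
    using sum.atLeast1_atMost_eq[of a m] by simp
  moreover have "(\<forall>t. min t n \<le> (\<Sum>i<min t n. a (Suc i))) \<longleftrightarrow> (\<forall>t\<le>n. t \<le> (\<Sum>i<t. a (Suc i)))"
    by (metis min.absorb1 min.cobounded2)
  ultimately show ?thesis
    by (simp add: dominating_def)
qed

text \<open>
  A dominating sequence on \<open>{1..n}\<close> becomes a Lukasiewicz word by appending the letter \<open>0\<close>.
  Conversely, the first \<open>n\<close> letters of a Lukasiewicz word already sum to at least \<open>n\<close>, which is the
  whole sum, so its last letter is \<open>0\<close>.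
\<close>
lemma card_dominating_eq_card_lukasiewicz:
  "card {a. dominating {1..n} a \<and> (\<forall>i. a i \<le> k)} = card {w \<in> bounded_words k n. lukasiewicz w}"
proof -
  let ?D = "{a. dominating {1..n} a \<and> (\<forall>i. a i \<le> k)}"
  let ?W = "{w \<in> bounded_words k n. lukasiewicz w}"
  define word where "word = (\<lambda>a::nat\<Rightarrow>nat. map a [1..<Suc n] @ [0])"
  define seq where "seq = (\<lambda>w::nat list. \<lambda>i. if i \<in> {1..n} then w ! (i - 1) else 0)"
  have word_nth: "word a ! i = (if i < n then a (Suc i) else 0)" if "i \<le> n" for a i
    using that by (auto simp: word_def nth_append less_Suc_eq_le simp del: upt_Suc)
  have length_word: "length (word a) = Suc n" for a
    by (simp add: word_def)
  have seq_Suc: "(\<Sum>i<t. seq w (Suc i)) = (\<Sum>i<t. w ! i)" if "t \<le> n" for w t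
    using that by (intro sum.cong) (auto simp: seq_def)
  have word_sum: "(\<Sum>i<t. word a ! i) = (\<Sum>i<t. a (Suc i))" if "t \<le> n" for a t
    using that by (intro sum.cong) (auto simp: word_nth)
  have W_iff: "w \<in> ?W \<longleftrightarrow> length w = Suc n \<and> w ! n = 0 \<and> (\<Sum>i<n. w ! i) = n \<and>
      (\<forall>t\<le>n. t \<le> (\<Sum>i<t. w ! i)) \<and> (\<forall>i<n. w ! i \<le> k)" for w
  proof (cases "length w = Suc n")
    case True
    have total: "sum_list w = (\<Sum>i<n. w ! i) + w ! n"
      using sum_list_take[of "Suc n" w] True by simp
    have "lukasiewicz w \<longleftrightarrow> (\<forall>t\<le>n. t \<le> (\<Sum>i<t. w ! i))"
      using True by (simp add: lukasiewicz_def sum_list_take less_Suc_eq_le)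
    moreover have "(\<forall>x\<in>set w. x \<le> k) \<longleftrightarrow> (\<forall>i<n. w ! i \<le> k) \<and> w ! n \<le> k"
      using True by (auto simp: all_set_conv_all_nth less_Suc_eq)
    moreover have "sum_list w = n \<and> n \<le> (\<Sum>i<n. w ! i) \<longleftrightarrow> w ! n = 0 \<and> (\<Sum>i<n. w ! i) = n"
      using total by auto
    moreover have "(\<forall>t\<le>n. t \<le> (\<Sum>i<t. w ! i)) \<Longrightarrow> n \<le> (\<Sum>i<n. w ! i)"
      by blast
    moreover have "w \<in> bounded_words k n \<longleftrightarrow> sum_list w = n \<and> (\<forall>x\<in>set w. x \<le> k)"
      using True by (simp add: bounded_words_def)
    ultimately show ?thesis
      using True by (metis (mono_tags, lifting) le0 mem_Collect_eq)
  next
    case False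
    then show ?thesis by (simp add: bounded_words_def)
  qed
  have "bij_betw word ?D ?W"
  proof (rule bij_betw_byWitness[where f' = seq])
    show "\<forall>a\<in>?D. seq (word a) = a"
      by (auto simp: seq_def word_nth dominating_def fun_eq_iff)
    show "\<forall>w\<in>?W. word (seq w) = w"
    proof
      fix w assume "w \<in> ?W"
      then have w: "length w = Suc n" "w ! n = 0" unfolding W_iff by auto
      show "word (seq w) = w"
      proof (rule nth_equalityI)
        fix i assume "i < length (word (seq w))"
        then show "word (seq w) ! i = w ! i"
          using w by (cases "i = n") (auto simp: length_word word_nth seq_def)
      qed (simp add: length_word w)
    qed
    show "word ` ?D \<subseteq> ?W"
      unfolding image_subset_iff W_iff mem_Collect_eq dominating_atLeastAtMost_iff
      by (simp add: length_word word_nth word_sum)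
    show "seq ` ?W \<subseteq> ?D"
    proof (rule image_subsetI)
      fix w assume w: "w \<in> ?W"
      then have "dominating {1..n} (seq w)"
        unfolding W_iff dominating_atLeastAtMost_iff by (simp add: seq_Suc) (simp add: seq_def)
      moreover have "seq w i \<le> k" for i
        using w unfolding W_iff by (auto simp: seq_def)
      ultimately show "seq w \<in> ?D" by simp
    qed
  qed
  then show ?thesis by (rule bij_betw_same_card)
qed

text \<open>
  Let \<open>H\<close> be the height of the walk that repeats \<open>w\<close> periodically; each period lowers it by \<open>1\<close>.
  The rotation starting at \<open>r\<close> is a Lukasiewicz word iff the walk does not go below \<open>H r\<close> during the
  period that follows. This happens exactly at the first minimum of \<open>H\<close> in a period: a
  later minimum is undercut once the first one recurs one unit lower.
\<close>
lemma cycle_lemma: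
  assumes len: "length w = Suc n" and total: "sum_list w = n"
  shows "\<exists>!r. r < Suc n \<and> lukasiewicz (rotate r w)"
proof -
  let ?N = "Suc n"
  define s where "s i = w ! (i mod ?N)" for i
  define H where "H j = int (\<Sum>i<j. s i) - int j" for j
  have shift: "(\<Sum>i<r+j. s i) = (\<Sum>i<r. s i) + (\<Sum>i<j. s (r + i))" for r j
    by (induction j) (simp_all add: algebra_simps)
  have "(\<Sum>i<?N. s i) = n"
    using sum_list_take[of ?N w] len total by (simp add: s_def)
  moreover have "s (?N + i) = s i" for i
    unfolding s_def by (metis mod_add_self1)
  ultimately have period: "H (j + ?N) = H j - 1" for j
    using shift[of ?N j] by (simp add: H_def add.commute)
  have luk_iff: "lukasiewicz (rotate r w) \<longleftrightarrow> (\<forall>j<?N. H r \<le> H (r + j))" for r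
  proof -
    have "sum_list (take j (rotate r w)) = (\<Sum>i<j. s (r + i))" if "j < ?N" for j
      using that len by (subst sum_list_take) (auto simp: s_def nth_rotate add.commute intro!: sum.cong)
    then show ?thesis
      using len by (auto simp: lukasiewicz_def H_def shift simp del: of_nat_sum)
  qed
  (* The first minimum of H in a period is the rotation sought. *)
  define min_at where "min_at r \<longleftrightarrow> r < ?N \<and> (\<forall>i<?N. H r \<le> H i)" for r
  have "\<exists>r. min_at r"
  proof -
    have "Min (H ` {..<?N}) \<in> H ` {..<?N}"
      by (intro Min_in) auto
    then obtain r where "r < ?N" "H r = Min (H ` {..<?N})" by auto
    then have "min_at r" by (simp add: min_at_def)
    then show ?thesis ..
  qed
  define r where "r = (LEAST r. min_at r)"
  have r: "min_at r"
    unfolding r_def using \<open>\<exists>r. min_at r\<close> by (rule LeastI_ex)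
  have first: "H r < H i" if "i < r" for i
  proof -
    have "\<not> min_at i" using not_less_Least that unfolding r_def by blast
    then show ?thesis
      using r that unfolding min_at_def by (meson less_trans not_le order_trans)
  qed
  have "H r \<le> H (r + j)" if "j < ?N" for j
  proof (cases "r + j < ?N")
    case True
    then show ?thesis using r by (simp add: min_at_def)
  next
    case False
    then have "r + j = (r + j - ?N) + ?N" "r + j - ?N < r"
      using that by auto
    then show ?thesis using period[of "r + j - ?N"] first[of "r + j - ?N"] by simp
  qed
  then have ex: "r < ?N \<and> lukasiewicz (rotate r w)"
    using r by (simp add: luk_iff min_at_def)
  have no_two: False if "r < r'" "r' < ?N" "\<forall>j<?N. H r \<le> H (r + j)" "\<forall>j<?N. H r' \<le> H (r' + j)" for r r'
  proof -
    have "H r \<le> H (r + (r' - r))" using that by (intro that(3)[rule_format]) auto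
    moreover have "H r' \<le> H (r' + (?N - (r' - r)))" using that by (intro that(4)[rule_format]) auto
    moreover have "r + (r' - r) = r'" "r' + (?N - (r' - r)) = r + ?N" using that by auto
    ultimately have "H r \<le> H r'" "H r' \<le> H (r + ?N)" by (simp_all only:)
    then show False unfolding period by simp
  qed
  show ?thesis
  proof (rule ex1I[of _ r])
    show "r < ?N \<and> lukasiewicz (rotate r w)" by (rule ex)
    fix q assume q: "q < ?N \<and> lukasiewicz (rotate q w)"
    then show "q = r"
      using ex no_two[of q r] no_two[of r q] luk_iff by (metis linorder_neqE_nat)
  qed
qed

text \<open>
  Double counting of the pairs of a word and a rotation that makes it a Lukasiewicz word: there is
  one rotation for each word, and rotating permutes the bounded words.
\<close>
lemma card_bounded_words_cycle:
  "card (bounded_words k n) = Suc n * card {w \<in> bounded_words k n. lukasiewicz w}"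
proof -
  let ?A = "bounded_words k n"
  have rot: "rotate r w \<in> ?A \<longleftrightarrow> w \<in> ?A" for r w
  proof -
    have "sum_list (rotate r w) = sum_list w"
    proof (induction r)
      case (Suc r)
      have "sum_list (rotate1 v) = sum_list v" for v :: "nat list"
        by (cases v) simp_all
      with Suc show ?case by simp
    qed simp
    then show ?thesis by (simp add: bounded_words_def)
  qed
  have inj: "inj_on (rotate r) X" for r and X :: "nat list set"
    unfolding rotate_def using inj_fn[OF inj_rotate1] by (rule inj_on_subset) simp
  have "card {w \<in> ?A. lukasiewicz (rotate r w)} = card {w \<in> ?A. lukasiewicz w}" if "r < Suc n" for r
  proof (rule bij_betw_same_card[of "rotate r"], rule bij_betw_imageI[OF inj], intro subset_antisym subsetI)
    fix w assume w: "w \<in> {w \<in> ?A. lukasiewicz w}"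
    then have "length w = Suc n" by (simp add: bounded_words_def)
    then have "w = rotate r (rotate (Suc n - r) w)"
      using that by (simp add: rotate_rotate del: rotate_Suc)
    then show "w \<in> rotate r ` {w \<in> ?A. lukasiewicz (rotate r w)}"
      using w rot by (metis (mono_tags, lifting) imageI mem_Collect_eq)
  qed (auto simp: rot)
  then have "(\<Sum>r<Suc n. card {w \<in> ?A. lukasiewicz (rotate r w)}) = Suc n * card {w \<in> ?A. lukasiewicz w}"
    by simp
  moreover have "(\<Sum>r<Suc n. card {w \<in> ?A. lukasiewicz (rotate r w)})
      = (\<Sum>r<Suc n. \<Sum>w\<in>?A. if lukasiewicz (rotate r w) then 1 else 0)"
    using finite_bounded_words by (intro sum.cong refl) (simp add: sum.inter_filter[symmetric])
  moreover have "\<dots> = (\<Sum>w\<in>?A. \<Sum>r<Suc n. if lukasiewicz (rotate r w) then 1 else 0)"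
    by (rule sum.swap)
  moreover have "\<dots> = (\<Sum>w\<in>?A. 1)"
  proof (rule sum.cong[OF refl])
    fix w assume "w \<in> ?A"
    then obtain r where "{r \<in> {..<Suc n}. lukasiewicz (rotate r w)} = {r}"
      using cycle_lemma[of w n] by (auto simp: bounded_words_def)
    then show "(\<Sum>r<Suc n. if lukasiewicz (rotate r w) then 1 else 0) = (1::nat)"
      by (subst sum.inter_filter[symmetric]) auto
  qed
  ultimately show ?thesis by simp
qed

lemma bounded_words_trivial_bound: "card (bounded_words n n) = (2 * n) choose n"
proof -
  have "bounded_words n n = {w. length w = Suc n \<and> sum_list w = n}"
    by (auto simp: bounded_words_def dest: member_le_sum_list)
  then show ?thesis
    using card_length_sum_list[of "Suc n" n] by (simp add: mult_2)
qed


section \<open>The exact distribution of the largest block\<close>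

lemma card_bounded_words_eq_coeff:
  "real (card (bounded_words k n)) = fps_nth (Abs_fps (\<lambda>i. if i \<le> k then 1 else 0) ^ Suc n) n"
proof -
  have fin: "finite (natpermute n (Suc n))" by (simp add: natpermute_finite)
  have "bounded_words k n = {w \<in> natpermute n (Suc n). \<forall>j\<in>{0..n}. w ! j \<le> k}"
    by (auto simp: bounded_words_def natpermute_def all_set_conv_all_nth less_Suc_eq_le)
  moreover have "(\<Prod>j\<in>{0..n}. if w ! j \<le> k then 1 else 0 :: real)
      = (if \<forall>j\<in>{0..n}. w ! j \<le> k then 1 else 0)" for w
    by (auto simp: prod_zero)
  ultimately show ?thesis
    using fin by (simp add: fps_power_nth_Suc sum.inter_filter[symmetric] del: power_Suc)
qed

text \<open>
  The generating polynomial of a single letter is \<open>(1 - z^(k+1)) / (1 - z)\<close>. The \<open>j\<close>-th term comes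
  from the binomial expansion of \<open>(1 - z^(k+1))^(n+1)\<close>, and the remaining factor
  \<open>(1 - z)^(-(n+1))\<close> has the coefficients \<open>C(n+i, i)\<close>.
\<close>
lemma card_bounded_words:
  "real (card (bounded_words k n))
     = (\<Sum>j\<le>Suc n. (-1)^j * real (Suc n choose j) *
          (if j * Suc k \<le> n then real ((2 * n - j * Suc k) choose n) else 0))"
proof -
  let ?X = "fps_X :: real fps"
  define T where "T = Abs_fps (\<lambda>i. if i \<le> k then 1 else (0::real))"
  define G where "G = Abs_fps (\<lambda>i. real ((n + i) choose i))"
  have TX: "T * (1 - ?X) = 1 - ?X ^ Suc k"
  proof (rule fps_ext)
    fix i
    show "fps_nth (T * (1 - ?X)) i = fps_nth (1 - ?X ^ Suc k) i"
      by (cases i) (auto simp: T_def right_diff_distrib fps_X_power_nth simp del: power_Suc)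
  qed
  have "inverse ((1 - ?X) ^ Suc n) = G"
    using one_minus_const_fps_X_neg_power'[of "Suc n" "1::real"] by (simp add: G_def)
  then have inv: "(1 - ?X) ^ Suc n * G = 1"
    by (metis inverse_mult_eq_1' fps_nth_power_0 fps_sub_nth fps_one_nth fps_X_nth diff_zero power_one zero_neq_one)
  have "T ^ Suc n = (T * (1 - ?X)) ^ Suc n * G"
    unfolding power_mult_distrib mult.assoc inv by simp
  also have "\<dots> = (- (?X ^ Suc k) + 1) ^ Suc n * G"
    unfolding TX by simp
  also have "(- (?X ^ Suc k) + 1) ^ Suc n
      = (\<Sum>j\<le>Suc n. fps_const ((-1)^j * real (Suc n choose j)) * ?X ^ (j * Suc k))"
    unfolding binomial_ring
  proof (rule sum.cong[OF refl])
    fix j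
    have "(- (?X ^ Suc k)) ^ j = fps_const ((-1)^j) * ?X ^ (j * Suc k)"
      by (subst power_minus) (simp add: power_mult[symmetric] mult.commute fps_const_power[symmetric] fps_const_neg[symmetric] del: power_Suc fps_const_power fps_const_neg)
    then show "of_nat (Suc n choose j) * (- (?X ^ Suc k)) ^ j * 1 ^ (Suc n - j)
        = fps_const ((-1)^j * real (Suc n choose j)) * ?X ^ (j * Suc k)"
      by (simp add: fps_of_nat[symmetric] mult_ac del: power_Suc)
  qed
  finally have "fps_nth (T ^ Suc n) n = (\<Sum>j\<le>Suc n. (-1)^j * real (Suc n choose j) *
      fps_nth (?X ^ (j * Suc k) * G) n)"
    by (simp only: sum_distrib_right fps_sum_nth mult.assoc fps_mult_left_const_nth)
  moreover have "fps_nth (?X ^ m * G) n = (if m \<le> n then real ((2 * n - m) choose n) else 0)" for m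
  proof (cases "m \<le> n")
    case True
    then have "(2 * n - m) choose (n - m) = (2 * n - m) choose n"
      using binomial_symmetric[of "n - m" "2 * n - m"] by simp
    then show ?thesis
      using True by (simp add: fps_X_power_mult_nth G_def mult_2)
  qed (simp add: fps_X_power_mult_nth)
  ultimately show ?thesis
    unfolding card_bounded_words_eq_coeff T_def[symmetric] by (simp only:)
qed

text \<open>
  Both the partitions with small blocks and all partitions (where the bound on the block size is
  \<open>n\<close>) are counted by bounded words, with the same factor \<open>n + 1\<close>.
\<close>
lemma prob_largest_block_le:
  assumes "n > 0"
  shows "measure_pmf.prob (random_noncrossing_partition n) {P. largest_block_size P \<le> k}
    = (\<Sum>j\<le>Suc n. (-1)^j * real (Suc n choose j) *
        (if j * Suc k \<le> n then real ((2 * n - j * Suc k) choose n) / real ((2 * n) choose n) else 0))"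
proof -
  let ?N = "noncrossing_partitions n"
  have count: "Suc n * card {P \<in> ?N. \<forall>B\<in>P. card B \<le> k} = card (bounded_words k n)" for k
    by (simp only: card_noncrossing_bounded_blocks card_dominating_eq_card_lukasiewicz
        card_bounded_words_cycle)
  have blocks: "finite P" "P \<noteq> {}" "\<forall>B\<in>P. card B \<le> n" if "P \<in> ?N" for P
  proof -
    have part: "partition_on {1..n} P" using that by (simp add: noncrossing_partitions_def)
    show "finite P" using part finite_elements by blast
    show "P \<noteq> {}" using part assms by (auto simp: partition_on_def)
    show "\<forall>B\<in>P. card B \<le> n"
      using partition_on_block(3)[OF _ part] card_mono[of "{1..n}"] by fastforce
  qed
  have eq1: "?N \<inter> {P. largest_block_size P \<le> k} = {P \<in> ?N. \<forall>B\<in>P. card B \<le> k}"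
    using blocks by (auto simp: largest_block_size_def)
  have eq2: "?N = {P \<in> ?N. \<forall>B\<in>P. card B \<le> n}"
    using blocks by blast
  have "Suc n * card ?N = (2 * n) choose n"
    using count[of n] eq2 bounded_words_trivial_bound[of n] by simp
  then have total: "real (Suc n) * real (card ?N) = real ((2 * n) choose n)"
    by (metis of_nat_mult)
  have "measure_pmf.prob (random_noncrossing_partition n) {P. largest_block_size P \<le> k}
      = real (card {P \<in> ?N. \<forall>B\<in>P. card B \<le> k}) / real (card ?N)"
    unfolding random_noncrossing_partition_def
    by (simp add: measure_pmf_of_set finite_noncrossing_partitions noncrossing_partitions_nonempty eq1)
  also have "\<dots> = (real (Suc n) * real (card {P \<in> ?N. \<forall>B\<in>P. card B \<le> k})) / (real (Suc n) * real (card ?N))"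
    by (simp del: of_nat_Suc)
  also have "\<dots> = real (card (bounded_words k n)) / real ((2 * n) choose n)"
    unfolding total count[symmetric] by (simp only: of_nat_mult)
  also have "\<dots> = (\<Sum>j\<le>Suc n. (-1)^j * real (Suc n choose j) *
        (if j * Suc k \<le> n then real ((2 * n - j * Suc k) choose n) / real ((2 * n) choose n) else 0))"
    unfolding card_bounded_words sum_divide_distrib by (intro sum.cong refl) simp
  finally show ?thesis .
qed


section \<open>Approximation by an exponential series\<close>

text \<open>
  The step that accumulates the relative errors of a product of factors below \<open>1\<close>.
\<close>
lemma one_minus_le_mult_one_minus:
  fixes u v w :: real
  assumes "0 \<le> u * v" "u + v \<le> w"
  shows "1 - w \<le> (1 - u) * (1 - v)"
  using assms by (simp add: algebra_simps)

lemma central_binomial_ratio_Suc: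
  assumes "m < n"
  shows "real ((2 * n - Suc m) choose n)
    = real ((2 * n - m) choose n) * ((real n - real m) / (2 * real n - real m))"
proof -
  have "(2 * n - m - n) * ((2 * n - m) choose n) = (2 * n - m) * ((2 * n - Suc m) choose n)"
    using binomial_absorb_comp[of "2 * n - m" n] by simp
  moreover have "2 * n - m - n = n - m" by simp
  ultimately have "real (n - m) * real ((2 * n - m) choose n)
      = real (2 * n - m) * real ((2 * n - Suc m) choose n)"
    by (metis of_nat_mult)
  then show ?thesis
    using assms by (simp add: of_nat_diff field_simps)
qed

text \<open>
  Each factor \<open>(n - i) / (2n - i)\<close> of the quotient is at most one half.
\<close>
lemma central_binomial_ratio_le:
  assumes "m \<le> n"
  shows "2 ^ m * (real ((2 * n - m) choose n) / real ((2 * n) choose n)) \<le> 1"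
  using assms
proof (induction m)
  case (Suc m)
  let ?R = "\<lambda>m. real ((2 * n - m) choose n) / real ((2 * n) choose n)"
  define f where "f = (real n - real m) / (2 * real n - real m)"
  have "real ((2 * n - Suc m) choose n) = real ((2 * n - m) choose n) * f"
    using central_binomial_ratio_Suc[of m n] Suc.prems by (simp only: f_def Suc_le_eq)
  then have "2 ^ Suc m * ?R (Suc m) = (2 ^ m * ?R m) * (2 * f)"
    by (simp add: mult_ac)
  also have "\<dots> \<le> 1 * 1"
  proof (rule mult_mono)
    show "2 * f \<le> 1" "0 \<le> 2 * f"
      using Suc.prems by (auto simp: f_def divide_le_eq)
  qed (use Suc in auto)
  finally show ?case by simp
qed simp

text \<open>
  Each factor \<open>(n - i) / (2n - i)\<close> is at least \<open>(1 - i/n) / 2\<close>, and the errors \<open>i/n\<close> add up to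
  at most \<open>m\<^sup>2 / n\<close>.
\<close>
lemma central_binomial_ratio_ge:
  assumes "m \<le> n" "n > 0"
  shows "2 ^ m * (real ((2 * n - m) choose n) / real ((2 * n) choose n)) \<ge> 1 - (real m)\<^sup>2 / real n"
  using assms(1)
proof (induction m)
  case (Suc m)
  let ?R = "\<lambda>m. real ((2 * n - m) choose n) / real ((2 * n) choose n)"
  have m: "m < n" using Suc.prems by simp
  define f where "f = (real n - real m) / (2 * real n - real m)"
  have R: "real ((2 * n - Suc m) choose n) = real ((2 * n - m) choose n) * f"
    using central_binomial_ratio_Suc[OF m] by (simp only: f_def)
  have "1 - real m / real n = 2 * ((real n - real m) / (2 * real n))"
    using assms(2) by (simp add: field_simps)
  also have "\<dots> \<le> 2 * f"
    unfolding f_def using m by (intro mult_left_mono divide_left_mono) auto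
  finally have f: "1 - real m / real n \<le> 2 * f" .
  show ?case
  proof (cases "(real m)\<^sup>2 \<le> real n")
    case True
    have "1 - (real (Suc m))\<^sup>2 / real n \<le> (1 - (real m)\<^sup>2 / real n) * (1 - real m / real n)"
    proof (rule one_minus_le_mult_one_minus)
      show "(real m)\<^sup>2 / real n + real m / real n \<le> (real (Suc m))\<^sup>2 / real n"
        unfolding add_divide_distrib[symmetric]
        by (intro divide_right_mono) (auto simp: power2_eq_square algebra_simps)
    qed simp
    also have "\<dots> \<le> (2 ^ m * ?R m) * (2 * f)"
      using Suc m True f by (intro mult_mono) auto
    also have "\<dots> = 2 ^ Suc m * ?R (Suc m)"
      using R by (simp add: mult_ac)
    finally show ?thesis .
  next
    case False
    then have "real n \<le> (real (Suc m))\<^sup>2"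
      by (smt (verit) of_nat_Suc of_nat_0_le_iff power2_sum power_one zero_le_mult_iff)
    then have "1 - (real (Suc m))\<^sup>2 / real n \<le> 0" using assms(2) by simp
    then show ?thesis by (smt (verit) divide_nonneg_nonneg of_nat_0_le_iff zero_le_mult_iff zero_le_power)
  qed
qed simp

lemma binomial_Suc_mult:
  "real (Suc n choose Suc j) * real (Suc j) = real (Suc n choose j) * (real n + 1 - real j)"
proof (cases "j \<le> Suc n")
  case True
  have "Suc j * (Suc n choose Suc j) = (Suc n - j) * (Suc n choose j)"
    using binomial_absorption[of j "Suc n"] binomial_absorb_comp[of "Suc n" j] by simp
  then have "real (Suc j) * real (Suc n choose Suc j) = real (Suc n - j) * real (Suc n choose j)"
    by (metis of_nat_mult)
  then show ?thesis using True by (simp add: of_nat_diff mult.commute)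
next
  case False
  then show ?thesis by (simp add: binomial_eq_0)
qed

lemma binomial_scaled_Suc:
  assumes "n > 0"
  shows "real (Suc n choose Suc j) * fact (Suc j) / real n ^ Suc j
    = (real (Suc n choose j) * fact j / real n ^ j) * (1 - (real j - 1) / real n)"
proof -
  have "real (Suc n choose Suc j) * fact (Suc j) = real (Suc n choose j) * (real n + 1 - real j) * fact j"
    using binomial_Suc_mult[of n j] by (metis (no_types, opaque_lifting) fact_Suc mult.assoc)
  then have "real (Suc n choose Suc j) * fact (Suc j) / real n ^ Suc j
      = real (Suc n choose j) * (real n + 1 - real j) * fact j / real n ^ Suc j"
    by simp
  also have "\<dots> = (real (Suc n choose j) * fact j / real n ^ j) * ((real n + 1 - real j) / real n)"
    by (simp add: mult_ac)
  also have "(real n + 1 - real j) / real n = 1 - (real j - 1) / real n"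
    using assms by (simp add: field_simps)
  finally show ?thesis .
qed

text \<open>
  The scaled binomial coefficient is the product of the factors \<open>1 - (i - 1) / n\<close> for \<open>i < j\<close>; only
  the factor for \<open>i = 0\<close> exceeds \<open>1\<close>.
\<close>
lemma binomial_scaled_le:
  assumes "n > 0"
  shows "real (Suc n choose Suc j) * fact (Suc j) / real n ^ Suc j \<le> 1 + 1 / real n"
proof (induction j)
  case 0
  show ?case using assms by (simp add: field_simps)
next
  case (Suc j)
  have "(real (Suc n choose Suc j) * fact (Suc j) / real n ^ Suc j) * (1 - (real (Suc j) - 1) / real n)
      \<le> (real (Suc n choose Suc j) * fact (Suc j) / real n ^ Suc j) * 1"
    using assms by (intro mult_left_mono) auto
  then show ?case
    using Suc binomial_scaled_Suc[OF assms, of "Suc j"] by linarith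
qed

lemma binomial_scaled_ge:
  assumes "n > 0"
  shows "1 - (real j)\<^sup>2 / real n \<le> real (Suc n choose j) * fact j / real n ^ j"
proof (induction j)
  case (Suc j)
  show ?case
  proof (cases "(real j)\<^sup>2 \<le> real n")
    case True
    then have "j \<le> n"
      by (metis dual_order.trans of_nat_le_iff of_nat_power le_square power2_eq_square)
    have "1 - (real (Suc j))\<^sup>2 / real n \<le> (1 - (real j)\<^sup>2 / real n) * (1 - (real j - 1) / real n)"
    proof (cases "j = 0")
      case False
      then have "0 \<le> (real j)\<^sup>2 / real n * ((real j - 1) / real n)" by simp
      moreover have "(real j)\<^sup>2 / real n + (real j - 1) / real n \<le> (real (Suc j))\<^sup>2 / real n"
        unfolding add_divide_distrib[symmetric]
        by (intro divide_right_mono) (auto simp: power2_eq_square algebra_simps)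
      ultimately show ?thesis by (rule one_minus_le_mult_one_minus)
    qed (use assms in \<open>simp add: field_simps\<close>)
    also have "\<dots> \<le> (real (Suc n choose j) * fact j / real n ^ j) * (1 - (real j - 1) / real n)"
      using Suc assms \<open>j \<le> n\<close> by (intro mult_right_mono) (auto simp: field_simps)
    also have "\<dots> = real (Suc n choose Suc j) * fact (Suc j) / real n ^ Suc j"
      using binomial_scaled_Suc[OF assms] by simp
    finally show ?thesis .
  next
    case False
    then have "real n \<le> (real (Suc j))\<^sup>2"
      by (smt (verit) of_nat_Suc of_nat_0_le_iff power2_sum power_one zero_le_mult_iff)
    then have "1 - (real (Suc j))\<^sup>2 / real n \<le> 0" using assms by simp
    also have "0 \<le> real (Suc n choose Suc j) * fact (Suc j) / real n ^ Suc j" by simp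
    finally show ?thesis .
  qed
qed simp

text \<open>
  The term is \<open>lam^j / j!\<close> times \<open>b c\<close>, where \<open>b\<close> is the scaled binomial coefficient and \<open>c\<close> the
  scaled quotient. With \<open>d = (j K)\<^sup>2 / n\<close> one has \<open>1 - d \<le> b \<le> 1 + d\<close> and \<open>1 - d \<le> c \<le> 1\<close>, hence
  \<open>\<bar>b c - 1\<bar> \<le> 2 d\<close>. The factor \<open>j\<^sup>2\<close> in \<open>d\<close> is absorbed into \<open>4^j\<close>, which keeps the bound
  summable in closed form.
\<close>
lemma inclusion_exclusion_term_bound:
  fixes n K j :: nat
  assumes n: "n > 0" and K: "K > 0"
  defines "lam \<equiv> real n / 2 ^ K"
  shows "\<bar>real (Suc n choose j) *
      (if j * K \<le> n then real ((2 * n - j * K) choose n) / real ((2 * n) choose n) else 0)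
      - lam ^ j / fact j\<bar> \<le> 2 * (real K)\<^sup>2 / real n * ((4 * lam) ^ j / fact j)"
proof -
  define m where "m = j * K"
  define b where "b = real (Suc n choose j) * fact j / real n ^ j"
  define c where "c = (if m \<le> n then 2 ^ m * (real ((2 * n - m) choose n) / real ((2 * n) choose n)) else 0)"
  define d where "d = (real m)\<^sup>2 / real n"
  have jm: "j \<le> m" using K by (simp add: m_def)
  have c: "0 \<le> c" "c \<le> 1" "1 - d \<le> c"
  proof -
    show "0 \<le> c" by (simp add: c_def)
    show "c \<le> 1" using central_binomial_ratio_le by (simp add: c_def)
    show "1 - d \<le> c"
    proof (cases "m \<le> n")
      case True
      then show ?thesis using central_binomial_ratio_ge[OF True n] by (simp add: c_def d_def)
    next
      case False
      then have "real n \<le> real m" "1 \<le> real m" by auto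
      then have "real n * 1 \<le> (real m)\<^sup>2" unfolding power2_eq_square by (intro mult_mono) auto
      then show ?thesis using False n by (simp add: c_def d_def)
    qed
  qed
  have d0: "0 \<le> d" by (simp add: d_def)
  have b0: "0 \<le> b" by (simp add: b_def)
  have "(real j)\<^sup>2 / real n \<le> d"
    unfolding d_def using jm by (intro divide_right_mono power_mono) auto
  then have b1: "1 - d \<le> b"
    using binomial_scaled_ge[OF n, of j] unfolding b_def by linarith
  have b2: "b \<le> 1 + d"
  proof (cases j)
    case (Suc i)
    have "1 \<le> (real m)\<^sup>2" using jm Suc by (simp add: one_le_power)
    then have "1 / real n \<le> d" unfolding d_def by (intro divide_right_mono) auto
    then show ?thesis using binomial_scaled_le[OF n, of i] unfolding b_def Suc by linarith
  qed (use d0 in \<open>simp add: b_def\<close>)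
  have "b * c \<le> (1 + d) * 1"
    using b2 c d0 by (intro mult_mono) auto
  moreover have "1 - 2 * d \<le> b * c"
  proof (cases "d \<le> 1")
    case True
    have "1 - 2 * d \<le> (1 - d) * (1 - d)" by (simp add: algebra_simps)
    also have "\<dots> \<le> b * c" using True b1 b0 c by (intro mult_mono) auto
    finally show ?thesis .
  next
    case False
    then show ?thesis using b0 c mult_nonneg_nonneg[of b c] by linarith
  qed
  ultimately have bc: "\<bar>b * c - 1\<bar> \<le> 2 * d"
    using d0 unfolding abs_le_iff by simp
  have lam: "lam ^ j = real n ^ j / 2 ^ m"
    by (simp add: lam_def m_def power_divide power_mult[symmetric] mult.commute)
  have "real (Suc n choose j) * (if m \<le> n then real ((2 * n - m) choose n) / real ((2 * n) choose n) else 0)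
      = lam ^ j / fact j * (b * c)"
    using n by (simp add: lam b_def c_def del: binomial_Suc_Suc)
  then have "\<bar>real (Suc n choose j) * (if m \<le> n then real ((2 * n - m) choose n) / real ((2 * n) choose n) else 0)
      - lam ^ j / fact j\<bar> = \<bar>lam ^ j / fact j * (b * c - 1)\<bar>"
    by (simp add: right_diff_distrib)
  also have "\<dots> = lam ^ j / fact j * \<bar>b * c - 1\<bar>"
    by (simp add: abs_mult lam_def)
  also have "\<dots> \<le> lam ^ j / fact j * (2 * d)"
    using bc by (intro mult_left_mono) (auto simp: lam_def)
  also have "\<dots> = 2 * (real K)\<^sup>2 / real n * (lam ^ j * (real j)\<^sup>2 / fact j)"
    by (simp add: d_def m_def power_mult_distrib mult_ac)
  also have "\<dots> \<le> 2 * (real K)\<^sup>2 / real n * ((4 * lam) ^ j / fact j)"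
  proof -
    have "real j \<le> 2 ^ j" by (rule less_imp_le[OF of_nat_less_two_power])
    then have "(real j)\<^sup>2 \<le> (2 ^ j)\<^sup>2" by (intro power_mono) auto
    also have "(2 ^ j)\<^sup>2 = (4::real) ^ j" by (simp add: power2_eq_square flip: power_mult_distrib)
    finally have "lam ^ j * (real j)\<^sup>2 \<le> lam ^ j * 4 ^ j"
      by (rule mult_left_mono) (simp add: lam_def)
    also have "\<dots> = (4 * lam) ^ j"
      by (simp only: power_mult_distrib mult.commute)
    finally have "lam ^ j * (real j)\<^sup>2 \<le> (4 * lam) ^ j" .
    then show ?thesis by (intro mult_left_mono divide_right_mono) auto
  qed
  finally show ?thesis by (simp only: m_def)
qed

text \<open>
  The alternating sum and the series of \<open>exp (-lam)\<close> are compared term by term. The finite sum is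
  regarded as a series, since its terms vanish for \<open>j > n + 1\<close>.
\<close>
lemma prob_largest_block_le_approx:
  fixes n k :: nat
  assumes n: "n > 0"
  defines "lam \<equiv> real n / 2 ^ Suc k"
  shows "\<bar>measure_pmf.prob (random_noncrossing_partition n) {P. largest_block_size P \<le> k} - exp (- lam)\<bar>
    \<le> 2 * (real (Suc k))\<^sup>2 / real n * exp (4 * lam)"
proof -
  let ?p = "measure_pmf.prob (random_noncrossing_partition n) {P. largest_block_size P \<le> k}"
  define a where "a j = real (Suc n choose j) * (if j * Suc k \<le> n
      then real ((2 * n - j * Suc k) choose n) / real ((2 * n) choose n) else 0)" for j
  have "(\<lambda>j. (-1)^j * a j) sums (\<Sum>j\<le>Suc n. (-1)^j * a j)"
    by (rule sums_finite) (auto simp: a_def binomial_eq_0)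
  moreover have "(\<Sum>j\<le>Suc n. (-1)^j * a j) = ?p"
    unfolding prob_largest_block_le[OF n] a_def by (simp only: mult.assoc)
  ultimately have "(\<lambda>j. (-1)^j * a j) sums ?p" by (simp only:)
  moreover have "(\<lambda>j. (- lam) ^ j / fact j) sums exp (- lam)"
    using exp_converges[of "- lam"] by (simp add: divide_inverse mult.commute)
  ultimately have diff: "(\<lambda>j. (-1)^j * a j - (- lam) ^ j / fact j) sums (?p - exp (- lam))"
    by (rule sums_diff)
  have "(\<lambda>j. (4 * lam) ^ j / fact j) sums exp (4 * lam)"
    using exp_converges[of "4 * lam"] by (simp add: divide_inverse mult.commute)
  then have bound: "(\<lambda>j. 2 * (real (Suc k))\<^sup>2 / real n * ((4 * lam) ^ j / fact j))
      sums (2 * (real (Suc k))\<^sup>2 / real n * exp (4 * lam))"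
    by (rule sums_mult)
  have "norm ((-1)^j * a j - (- lam) ^ j / fact j)
      \<le> 2 * (real (Suc k))\<^sup>2 / real n * ((4 * lam) ^ j / fact j)" for j
  proof -
    have "(-1)^j * a j - (- lam) ^ j / fact j = (-1)^j * (a j - lam ^ j / fact j)"
      by (subst power_minus) (simp add: right_diff_distrib)
    then have "norm ((-1)^j * a j - (- lam) ^ j / fact j) = \<bar>a j - lam ^ j / fact j\<bar>"
      by (simp add: abs_mult)
    then show ?thesis
      using inclusion_exclusion_term_bound[OF n, of "Suc k" j] by (simp only: a_def lam_def zero_less_Suc)
  qed
  from norm_sums_le[OF diff bound this] show ?thesis by simp
qed


section \<open>The largest block near its typical size\<close>

text \<open>
  The fractional part in \<open>alpha\<close> restores what the floor in the choice of \<open>k\<close> cuts off.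
\<close>
lemma alpha_scaled:
  assumes n: "n > 0" and k: "int k = \<lfloor>log 2 (real n)\<rfloor> + x"
  shows "alpha n * 2 powi (- (x + 1)) = real n / 2 ^ Suc k"
proof -
  have "alpha n * 2 powi (- (x + 1))
      = 2 powr (frac (log 2 (real n))) * 2 powr (of_int (- (x + 1)))"
    unfolding alpha_def by (subst powr_real_of_int') auto
  also have "\<dots> = 2 powr (log 2 (real n) - real (Suc k))"
  proof -
    have "real_of_int (int k) = of_int (\<lfloor>log 2 (real n)\<rfloor> + x)" by (simp only: k)
    then have "frac (log 2 (real n)) + of_int (- (x + 1)) = log 2 (real n) - real (Suc k)"
      by (simp add: frac_def)
    then show ?thesis by (simp only: powr_add[symmetric])
  qed
  also have "\<dots> = real n / 2 ^ Suc k"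
    using n powr_realpow[of 2 "Suc k"] by (simp only: powr_diff) simp
  finally show ?thesis .
qed

theorem theorem2p10:
  fixes x :: int
  shows "\<exists>\<epsilon> :: nat \<Rightarrow> real. \<epsilon> \<in> O(\<lambda>n. (ln (real n))\<^sup>2 / real n) \<and>
    (\<forall>\<^sub>F n in sequentially.
       measure_pmf.prob (random_noncrossing_partition n)
         {P. int (largest_block_size P) \<le> \<lfloor>log 2 (real n)\<rfloor> + x}
       = exp (- alpha n * 2 powi (- (x + 1))) * (1 + \<epsilon> n))"
proof -
  define p where "p n = measure_pmf.prob (random_noncrossing_partition n)
      {P. int (largest_block_size P) \<le> \<lfloor>log 2 (real n)\<rfloor> + x}" for n
  define lam where "lam n = alpha n * 2 powi (- (x + 1))" for n
  (* The equation of the theorem forces this choice. *)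
  define \<epsilon> where "\<epsilon> n = p n * exp (lam n) - 1" for n
  (* An upper bound of lam, as alpha is less than 2. *)
  define L :: real where "L = 2 * 2 powi (- (x + 1))"
  define D where "D = 1 / ln 2 + \<bar>real_of_int x\<bar> + 1"
  have eq: "p n = exp (- lam n) * (1 + \<epsilon> n)" for n
    by (simp add: \<epsilon>_def exp_minus)
  have lam_le: "lam n \<le> L" for n
  proof -
    have "alpha n \<le> 2 powr 1"
      unfolding alpha_def using frac_lt_1[of "log 2 (real n)"] by (intro powr_mono) auto
    then show ?thesis unfolding lam_def L_def by (intro mult_right_mono) auto
  qed
  have "eventually (\<lambda>n. norm (\<epsilon> n) \<le> 2 * exp (5 * L) * D\<^sup>2 * norm ((ln (real n))\<^sup>2 / real n)) sequentially"
    (* The bound 3 makes ln n at least 1, so constants can be absorbed into it;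
       the power of 2 makes the block size bound nonnegative. *)
    using eventually_ge_at_top[of "max 3 (2 ^ nat \<bar>x\<bar>)"]
  proof eventually_elim
    case (elim n)
    then have n3: "n \<ge> 3" and npow: "2 ^ nat \<bar>x\<bar> \<le> n" by auto
    have "(2::real) ^ nat \<bar>x\<bar> \<le> real n"
      using npow by (metis of_nat_le_iff of_nat_numeral of_nat_power)
    then have "log 2 (2 ^ nat \<bar>x\<bar>) \<le> log 2 (real n)"
      using n3 by (subst log_le_cancel_iff) auto
    then have "real (nat \<bar>x\<bar>) \<le> log 2 (real n)"
      by simp
    then have "0 \<le> \<lfloor>log 2 (real n)\<rfloor> + x"
      by (smt (verit) le_floor_iff of_int_of_nat_eq of_int_abs nat_0_le of_nat_nat of_int_minus)
    then obtain k where k: "int k = \<lfloor>log 2 (real n)\<rfloor> + x"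
      using zero_le_imp_eq_int by metis
    have lam: "lam n = real n / 2 ^ Suc k"
      unfolding lam_def using n3 k by (intro alpha_scaled) auto
    have "p n = measure_pmf.prob (random_noncrossing_partition n) {P. largest_block_size P \<le> k}"
      unfolding p_def k[symmetric] by simp
    then have approx: "\<bar>p n - exp (- lam n)\<bar> \<le> 2 * (real (Suc k))\<^sup>2 / real n * exp (4 * lam n)"
      using prob_largest_block_le_approx[of n k] n3 lam by simp
    have "\<epsilon> n = (p n - exp (- lam n)) * exp (lam n)"
      by (simp add: \<epsilon>_def left_diff_distrib exp_minus)
    then have "\<bar>\<epsilon> n\<bar> = \<bar>p n - exp (- lam n)\<bar> * exp (lam n)"
      by (simp add: abs_mult)
    also have "\<dots> \<le> 2 * (real (Suc k))\<^sup>2 / real n * exp (4 * lam n) * exp (lam n)"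
      using approx by (intro mult_right_mono) auto
    also have "\<dots> = 2 * (real (Suc k))\<^sup>2 / real n * exp (5 * lam n)"
      by (simp add: exp_add[symmetric])
    also have "\<dots> \<le> 2 * (D * ln (real n))\<^sup>2 / real n * exp (5 * L)"
    proof -
      have "exp 1 \<le> real n" using e_less_272 n3 by linarith
      then have ln1: "1 \<le> ln (real n)" using n3 by (subst ln_ge_iff) auto
      have "real_of_int (int k) = of_int (\<lfloor>log 2 (real n)\<rfloor> + x)" by (simp only: k)
      then have "real (Suc k) \<le> log 2 (real n) + \<bar>real_of_int x\<bar> + 1"
        by simp linarith
      also have "\<dots> = ln (real n) / ln 2 + (\<bar>real_of_int x\<bar> + 1) * 1"
        by (simp add: log_def)
      also have "\<dots> \<le> ln (real n) / ln 2 + (\<bar>real_of_int x\<bar> + 1) * ln (real n)"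
        using ln1 by (intro add_left_mono mult_left_mono) auto
      also have "\<dots> = D * ln (real n)" by (simp add: D_def algebra_simps)
      finally have "(real (Suc k))\<^sup>2 \<le> (D * ln (real n))\<^sup>2" by (intro power_mono) auto
      moreover have "exp (5 * lam n) \<le> exp (5 * L)" using lam_le by simp
      ultimately show ?thesis by (intro mult_mono divide_right_mono mult_left_mono) auto
    qed
    also have "\<dots> = 2 * exp (5 * L) * D\<^sup>2 * norm ((ln (real n))\<^sup>2 / real n)"
      by (simp add: power_mult_distrib)
    finally show ?case by simp
  qed
  then have "\<epsilon> \<in> O(\<lambda>n. (ln (real n))\<^sup>2 / real n)"
    by (rule bigoI)
  moreover have "measure_pmf.prob (random_noncrossing_partition n)
      {P. int (largest_block_size P) \<le> \<lfloor>log 2 (real n)\<rfloor> + x}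
      = exp (- alpha n * 2 powi (- (x + 1))) * (1 + \<epsilon> n)" for n
    using eq[of n] by (simp add: p_def lam_def)
  ultimately show ?thesis by (intro exI[of _ \<epsilon>]) simp
qed

end
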